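(* Let $X$ be a normed space, $A\subset X$ a convex subset, and $x\in A$. The following are equivalent: (i) $x$ is a denting point of $A$. (ii) $x$ is a point of continuity for $A$ and a weakly strongly extreme point of $A$. (iii) $x$ is a point of continuity for $A$ and a preserved extreme point of $A$.
   Context: Normed spaces are real and not assumed complete; "weak" is the weak topology of $X$; $X$ is regarded as a subspace of $X^{**}$ through the canonical embedding. For a convex set $A\subset X$ and $x\in A$: - $x$ is a denting point of $A$ if for every $\epsilon>0$, $x\notin\overline{\mathrm{conv}}(A\setminus B_\epsilon(x))$, where $B_\epsilon(x)$ is the open ball with centre $x$ and radius $\epsilon$ and $\overline{\mathrm{conv}}$ is the closed convex hull. - $x$ is a point of continuity for $A$ if the identity map $(A,\text{weak})\to(A,\|\cdot\|)$ is continuous at $x$. - $x$ is a weakly strongly extreme point of $A$ if given two sequences $(a_n)_n$ and $(a'_n)_n$ in $A$ such that $\lim_n(a_n+a'_n)=2x$ (in norm), one has $\text{weak-}\lim_n a_n=x$. - $x$ is an extreme point of $A$ if $x$ does not belong to (the relative interior of) any non-degenerate line segment in $A$. An extreme point $x$ of $A$ is a preserved extreme point of $A$ if $x$ is also an extreme point of $\widetilde{A}$, the closure of $A$ in $X^{**}$ with respect to the weak$^*$ topology. *)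

theory Defs
  imports "HOL-Analysis.Analysis"
begin

(* The codomain carries the product topology, so this is the coarsest topology making every
   bounded linear functional continuous. *)
definition weak_topology :: "'a::real_normed_vector topology" where
  "weak_topology =
     pullback_topology UNIV (\<lambda>x f. blinfun_apply f x)
       (euclidean :: (('a \<Rightarrow>\<^sub>L real) \<Rightarrow> real) topology)"

(* For scalar-valued functionals the strong operator topology is the topology of pointwise
   convergence on 'b, that is, the weak* topology of the dual of 'b; the bidual of 'a is the
   instance where 'b is the dual of 'a. *)
abbreviation weak_star_topology :: "('b::real_normed_vector \<Rightarrow>\<^sub>L real) topology" where
  "weak_star_topology \<equiv> strong_operator_topology"

lift_definition bidual_embedding :: "'a::real_normed_vector \<Rightarrow> (('a \<Rightarrow>\<^sub>L real) \<Rightarrow>\<^sub>L real)"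
  is "\<lambda>x f. blinfun_apply f x"
  by (rule blinfun.bounded_linear_left)

definition denting_point :: "'a::real_normed_vector set \<Rightarrow> 'a \<Rightarrow> bool" where
  "denting_point A x \<longleftrightarrow>
     x \<in> A \<and> (\<forall>\<epsilon>>0. x \<notin> closure (convex hull (A - ball x \<epsilon>)))"

definition point_of_continuity :: "'a::real_normed_vector set \<Rightarrow> 'a \<Rightarrow> bool" where
  "point_of_continuity A x \<longleftrightarrow>
     topcontinuous_at (subtopology weak_topology A) (top_of_set A) id x"

definition weakly_strongly_extreme_point :: "'a::real_normed_vector set \<Rightarrow> 'a \<Rightarrow> bool" where
  "weakly_strongly_extreme_point A x \<longleftrightarrow>
     x \<in> A \<and>
     (\<forall>a a' :: nat \<Rightarrow> 'a.
        range a \<subseteq> A \<longrightarrow> range a' \<subseteq> A \<longrightarrow>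
        (\<lambda>n. a n + a' n) \<longlonglongrightarrow> 2 *\<^sub>R x \<longrightarrow>
        limitin weak_topology a x sequentially)"

definition preserved_extreme_point :: "'a::real_normed_vector set \<Rightarrow> 'a \<Rightarrow> bool" where
  "preserved_extreme_point A x \<longleftrightarrow>
     x extreme_point_of A \<and>
     bidual_embedding x extreme_point_of
       (weak_star_topology closure_of (bidual_embedding ` A))"

lemma topspace_weak_topology [simp]: "topspace weak_topology = UNIV"
  by (simp add: weak_topology_def topspace_pullback_topology)

lemma continuous_map_weak_topology_iff:
  "continuous_map T weak_topology g \<longleftrightarrow>
     (\<forall>f. continuous_map T euclideanreal (\<lambda>t. blinfun_apply f (g t)))"
  (is "?L \<longleftrightarrow> ?R")
proof
  assume L: ?L
  show ?R
  proof
    fix f :: "'b \<Rightarrow>\<^sub>L real"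
    have "continuous_map weak_topology euclidean ((\<lambda>\<phi>. \<phi> f) \<circ> (\<lambda>x f. blinfun_apply f x))"
      unfolding weak_topology_def
      by (rule continuous_map_pullback) (use continuous_on_product_coordinates in fastforce)
    then show "continuous_map T euclideanreal (\<lambda>t. blinfun_apply f (g t))"
      using continuous_map_compose[OF L] by (fastforce simp: comp_def)
  qed
next
  assume ?R
  then have "continuous_map T euclidean ((\<lambda>x (f :: 'b \<Rightarrow>\<^sub>L real). blinfun_apply f x) \<circ> g)"
    by (simp add: comp_def continuous_map_componentwise_UNIV flip: euclidean_product_topology)
  then show ?L
    unfolding weak_topology_def by (intro continuous_map_pullback') auto
qed

end

theory Submission
  imports Defs
begin

text \<open>
  A denting point lies in slices of \<open>A\<close> of arbitrarily small diameter, by separation from the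
  closed convex hull of the remaining part of \<open>A\<close>. Slices are weakly open, so it is a point of
  continuity. If the midpoint of two points of \<open>A\<close> is close to \<open>x\<close>, one of the two points lies in the
  slice, so it is close to \<open>x\<close> and the other one with it; hence \<open>x\<close> is weakly strongly extreme
  (\<open>denting_point_imp_weakly_strongly_extreme_point\<close>).

  Suppose next that \<open>x\<close> is weakly strongly extreme and lies on a segment between \<open>u\<close> and \<open>v\<close> in the
  weak* closure of \<open>A\<close>. Approximating \<open>u\<close> and \<open>v\<close> by points of \<open>A\<close> shows that \<open>x\<close> is a weak limit of
  corresponding convex combinations. These form a convex set, so \<open>x\<close> is also a norm limit of
  such combinations, and weak strong extremality applies to them: the endpoint with the larger weight
  must be \<open>x\<close> (\<open>weakly_strongly_extreme_point_imp_preserved_extreme_point\<close>).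

  Finally let \<open>x\<close> be a preserved extreme point of continuity. Weak* compactness shows that if \<open>x\<close>
  belongs to the closed convex hull of finitely many bounded convex subsets of \<open>A\<close>, it belongs to the
  closure of one of them (\<open>bidual_extreme_point_closure_Union\<close>). A weak neighbourhood of \<open>x\<close>
  contains a finite intersection of open slabs, so continuity of the identity at \<open>x\<close> covers the part of
  \<open>A\<close> on a small sphere around \<open>x\<close> by finitely many bounded convex sets whose closures miss \<open>x\<close>.
  Hence \<open>x\<close> is separated from that part, and by convexity of \<open>A\<close> from everything in \<open>A\<close> beyond it
  (\<open>preserved_extreme_point_imp_denting_point\<close>).

  The two tools from functional analysis are the separation of a point from a closed convex set, in
  the quantitative form \<open>separate_point_convex\<close>, and the existence of weak* cluster points of bounded
  sequences in the bidual, \<open>bounded_sequence_weak_star_cluster_point\<close>.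
\<close>

section \<open>Separation of a point from a convex set\<close>

definition sublinear :: "('a::real_vector \<Rightarrow> real) \<Rightarrow> bool" where
  "sublinear p \<longleftrightarrow>
     (\<forall>x y. p (x + y) \<le> p x + p y) \<and> (\<forall>c x. 0 \<le> c \<longrightarrow> p (c *\<^sub>R x) = c * p x)"

lemma sublinear_add: "sublinear p \<Longrightarrow> p (x + y) \<le> p x + p y"
  by (simp add: sublinear_def)

lemma sublinear_scale: "sublinear p \<Longrightarrow> 0 \<le> c \<Longrightarrow> p (c *\<^sub>R x) = c * p x"
  by (simp add: sublinear_def)

lemma sublinear_zero: "sublinear p \<Longrightarrow> p 0 = 0"
  using sublinear_scale[of p 0 0] by simp

lemma sublinear_minus: "sublinear p \<Longrightarrow> - p (- x) \<le> p x"
  using sublinear_add[of p x "- x"] sublinear_zero[of p] by simp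

lemma sublinearI:
  assumes zero: "p 0 \<le> 0"
    and add: "\<And>x y. p (x + y) \<le> p x + p y"
    and scale: "\<And>c x. 0 < c \<Longrightarrow> p (c *\<^sub>R x) \<le> c * p x"
  shows "sublinear p"
proof -
  have "p (c *\<^sub>R x) = c * p x" if "0 \<le> c" for c x
  proof (cases "c = 0")
    case True
    then show ?thesis using zero add[of 0 0] by simp
  next
    case False
    with that have c: "0 < c" by simp
    have "p x = p (inverse c *\<^sub>R (c *\<^sub>R x))" using c by simp
    also have "\<dots> \<le> inverse c * p (c *\<^sub>R x)" using c by (intro scale) simp
    finally have "c * p x \<le> p (c *\<^sub>R x)" using c by (simp add: field_simps)
    with scale[OF c, of x] show ?thesis by simp
  qed
  with add show ?thesis by (simp add: sublinear_def)
qed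

text \<open>
  This is how convexity enters below: non-negative multiples of two points of a convex set merge
  into one multiple of a single point of the set, the degenerate total weight \<open>0\<close> included.
\<close>
lemma convex_scaled_sum:
  assumes C: "convex C" "s \<in> C" "s' \<in> C" and t: "0 \<le> t" "0 \<le> t'"
  obtains s'' where "s'' \<in> C" "t *\<^sub>R s + t' *\<^sub>R s' = (t + t') *\<^sub>R s''"
proof (cases "t + t' = 0")
  case True
  with t have "t = 0" "t' = 0" by auto
  with C that show ?thesis by auto
next
  case False
  with t have pos: "0 < t + t'" by simp
  have "(t / (t + t')) *\<^sub>R s + (t' / (t + t')) *\<^sub>R s' \<in> C"
    using t pos by (intro convexD[OF C]) (auto simp flip: add_divide_distrib)
  moreover have "t *\<^sub>R s + t' *\<^sub>R s' =
      (t + t') *\<^sub>R ((t / (t + t')) *\<^sub>R s + (t' / (t + t')) *\<^sub>R s')"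
    using pos by (simp add: scaleR_add_right)
  ultimately show ?thesis by (rule that)
qed

text \<open>
  Linear functionals below \<open>p\<close> that are at least \<open>r\<close> on \<open>C\<close> are exactly the linear functionals
  below \<open>q y = Inf {p (y + t *\<^sub>R s) - t * r | t \<ge> 0, s \<in> C}\<close>. The hypothesis \<open>r \<le> p s\<close> bounds the
  infimum from below by \<open>- p (- y)\<close>, and convexity of \<open>C\<close> makes it subadditive. The same step with a
  singleton \<open>C\<close> and \<open>r = p a\<close> characterises the minimal sublinear functionals, so that no extension
  of functionals from subspaces is ever needed.
\<close>
lemma sublinear_push_down:
  fixes p :: "'a::real_vector \<Rightarrow> real"
  assumes p: "sublinear p" and C: "convex C" "C \<noteq> {}" and r: "\<And>s. s \<in> C \<Longrightarrow> r \<le> p s"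
  obtains q where "sublinear q" "\<And>x. q x \<le> p x" "\<And>s. s \<in> C \<Longrightarrow> q (- s) \<le> - r"
proof -
  define V where "V y = (\<lambda>(t, s). p (y + t *\<^sub>R s) - t * r) ` ({0..} \<times> C)" for y
  define q where "q y = Inf (V y)" for y
  have bound: "- p (- y) \<le> p (y + t *\<^sub>R s) - t * r" if "0 \<le> t" "s \<in> C" for y t s
  proof -
    have "t * r \<le> p (t *\<^sub>R s)"
      using r[of s] that by (simp add: sublinear_scale[OF p] mult_left_mono)
    also have "\<dots> \<le> p (y + t *\<^sub>R s) + p (- y)"
      using sublinear_add[OF p, of "y + t *\<^sub>R s" "- y"] by simp
    finally show ?thesis by simp
  qed
  have "bdd_below (V y)" for y
    unfolding bdd_below_def V_def using bound[of _ _ y] by fastforce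
  then have q_le: "q y \<le> p (y + t *\<^sub>R s) - t * r" if "0 \<le> t" "s \<in> C" for y t s
    unfolding q_def using that by (intro cInf_lower) (auto simp: V_def)
  have ne: "V y \<noteq> {}" for y using C by (auto simp: V_def)
  have q_ge: "m \<le> q y" if "\<And>t s. 0 \<le> t \<Longrightarrow> s \<in> C \<Longrightarrow> m \<le> p (y + t *\<^sub>R s) - t * r" for m y
    unfolding q_def using that ne by (intro cInf_greatest) (auto simp: V_def)
  obtain s0 where s0: "s0 \<in> C" using C by blast
  have q_le_p: "q x \<le> p x" for x using q_le[of 0 s0 x] s0 by simp
  have "sublinear q"
  proof (rule sublinearI)
    show "q 0 \<le> 0" using q_le_p[of 0] sublinear_zero[OF p] by simp
  next
    fix x y
    have main: "q (x + y) \<le> (p (x + t *\<^sub>R s) - t * r) + (p (y + t' *\<^sub>R s') - t' * r)"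
      if t: "0 \<le> t" "s \<in> C" "0 \<le> t'" "s' \<in> C" for t s t' s'
    proof -
      obtain s'' where s'': "s'' \<in> C" "t *\<^sub>R s + t' *\<^sub>R s' = (t + t') *\<^sub>R s''"
        using convex_scaled_sum[OF C(1)] t by metis
      have "q (x + y) \<le> p ((x + y) + (t + t') *\<^sub>R s'') - (t + t') * r"
        using t s'' by (intro q_le) auto
      also have "(x + y) + (t + t') *\<^sub>R s'' = (x + t *\<^sub>R s) + (y + t' *\<^sub>R s')"
        by (simp flip: s''(2))
      also have "p \<dots> \<le> p (x + t *\<^sub>R s) + p (y + t' *\<^sub>R s')"
        by (rule sublinear_add[OF p])
      finally show ?thesis by (simp add: algebra_simps)
    qed
    have "q (x + y) - q y \<le> p (x + t *\<^sub>R s) - t * r" if "0 \<le> t" "s \<in> C" for t s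
    proof -
      have "q (x + y) - (p (x + t *\<^sub>R s) - t * r) \<le> q y"
        using main[OF that] by (intro q_ge) (smt (verit))
      then show ?thesis by simp
    qed
    then have "q (x + y) - q y \<le> q x" by (rule q_ge)
    then show "q (x + y) \<le> q x + q y" by simp
  next
    fix c x assume c: "(0::real) < c"
    have "q (c *\<^sub>R x) / c \<le> p (x + t *\<^sub>R s) - t * r" if "0 \<le> t" "s \<in> C" for t s
    proof -
      have "q (c *\<^sub>R x) \<le> p (c *\<^sub>R x + (c * t) *\<^sub>R s) - (c * t) * r"
        using that c by (intro q_le) auto
      also have "c *\<^sub>R x + (c * t) *\<^sub>R s = c *\<^sub>R (x + t *\<^sub>R s)"
        by (simp add: scaleR_add_right)
      also have "p \<dots> = c * p (x + t *\<^sub>R s)"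
        using c by (simp add: sublinear_scale[OF p])
      finally show ?thesis using c by (simp add: field_simps)
    qed
    then have "q (c *\<^sub>R x) / c \<le> q x" by (rule q_ge)
    then show "q (c *\<^sub>R x) \<le> c * q x" using c by (simp add: field_simps)
  qed
  moreover have "q (- s) \<le> - r" if "s \<in> C" for s
    using q_le[of 1 s "- s"] that sublinear_zero[OF p] by simp
  ultimately show thesis using q_le_p that by blast
qed

text \<open>
  Pushing \<open>p\<close> down along a single point \<open>a\<close> must leave a minimal \<open>p\<close> unchanged, which forces
  \<open>p (- a) = - p a\<close>; a sublinear functional that is odd is linear.
\<close>
lemma minimal_sublinear_imp_linear:
  fixes p :: "'a::real_vector \<Rightarrow> real"
  assumes p: "sublinear p"
    and minimal: "\<And>q. sublinear q \<Longrightarrow> (\<And>x. q x \<le> p x) \<Longrightarrow> q = p"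
  shows "linear p"
proof -
  have minus: "p (- a) = - p a" for a
  proof -
    obtain q where q: "sublinear q" "\<And>x. q x \<le> p x" "\<And>s. s \<in> {a} \<Longrightarrow> q (- s) \<le> - p a"
      using sublinear_push_down[OF p, of "{a}" "p a"] by auto
    from minimal[OF q(1,2)] q(3)[of a] have "p (- a) \<le> - p a" by simp
    moreover have "- p a \<le> p (- a)" using sublinear_minus[OF p, of "- a"] by simp
    ultimately show ?thesis by simp
  qed
  show ?thesis
  proof (rule linearI)
    fix x y
    have "- p (x + y) \<le> - p x - p y"
      using sublinear_add[OF p, of "- x" "- y"] minus[of "x + y"] by (simp add: minus)
    with sublinear_add[OF p, of x y] show "p (x + y) = p x + p y" by simp
  next
    fix c x
    show "p (c *\<^sub>R x) = c *\<^sub>R p x"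
    proof (cases "0 \<le> c")
      case True then show ?thesis by (simp add: sublinear_scale[OF p])
    next
      case False
      then have "p (c *\<^sub>R x) = - p ((- c) *\<^sub>R x)" using minus[of "c *\<^sub>R x"] by simp
      also have "\<dots> = c * p x" using False by (subst sublinear_scale[OF p]) auto
      finally show ?thesis by simp
    qed
  qed
qed

text \<open>
  The Hahn--Banach theorem. Zorn's lemma yields a minimal sublinear functional below \<open>p\<close>: the
  pointwise infimum of a chain is finite because every member lies above \<open>- p (- x)\<close>, and it is
  subadditive because of any two members of the chain one lies below both.
\<close>
lemma sublinear_dominates_linear:
  fixes p :: "'a::real_vector \<Rightarrow> real"
  assumes p: "sublinear p"
  obtains f where "linear f" "\<And>x. f x \<le> p x"
proof -
  define S where "S = {q. sublinear q \<and> (\<forall>x. q x \<le> p x)}"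
  define P :: "('a \<Rightarrow> real) \<Rightarrow> ('a \<Rightarrow> real) \<Rightarrow> bool" where "P q q' \<longleftrightarrow> q' \<le> q" for q q'
  have "partial_order_on S (relation_of P S)"
    by (rule partial_order_on_relation_ofI) (auto simp: P_def)
  moreover have "\<exists>u\<in>S. \<forall>a\<in>K. P a u" if K: "K \<in> Chains (relation_of P S)" for K
  proof (cases "K = {}")
    case True
    then show ?thesis using p by (auto simp: S_def)
  next
    case False
    have KS: "q \<in> S" if "q \<in> K" for q
      using K that by (auto simp: Chains_def relation_of_def)
    have total: "q \<le> q' \<or> q' \<le> q" if "q \<in> K" "q' \<in> K" for q q'
      using K that by (auto simp: Chains_def relation_of_def P_def)
    have lower: "- p (- x) \<le> q x" if "q \<in> K" for q x
    proof -
      have "- p (- x) \<le> - q (- x)" using KS[OF that] by (simp add: S_def)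
      also have "\<dots> \<le> q x" using KS[OF that] by (simp add: S_def sublinear_minus)
      finally show ?thesis .
    qed
    define u where "u x = (INF q\<in>K. q x)" for x
    have u_le: "u x \<le> q x" if "q \<in> K" for q x
      unfolding u_def using that lower by (intro cINF_lower) (auto simp: bdd_below_def)
    have u_ge: "m \<le> u x" if "\<And>q. q \<in> K \<Longrightarrow> m \<le> q x" for m x
      unfolding u_def using that False by (intro cINF_greatest)
    obtain q0 where q0: "q0 \<in> K" using False by blast
    have "sublinear u"
    proof (rule sublinearI)
      show "u 0 \<le> 0"
        using u_le[OF q0, of 0] KS[OF q0] sublinear_zero[of q0] by (simp add: S_def)
    next
      fix x y
      have main: "u (x + y) \<le> q x + q' y" if qs: "q \<in> K" "q' \<in> K" for q q'
      proof -
        obtain w where w: "w \<in> K" "w \<le> q" "w \<le> q'" using total[OF qs] qs by blast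
        have "u (x + y) \<le> w (x + y)" by (rule u_le[OF w(1)])
        also have "\<dots> \<le> w x + w y"
          using KS[OF w(1)] by (simp add: S_def sublinear_add)
        also have "\<dots> \<le> q x + q' y" using w by (simp add: le_fun_def add_mono)
        finally show ?thesis .
      qed
      have "u (x + y) - u y \<le> q x" if "q \<in> K" for q
      proof -
        have "u (x + y) - q x \<le> u y" using main[OF that] by (intro u_ge) (smt (verit))
        then show ?thesis by simp
      qed
      then have "u (x + y) - u y \<le> u x" by (rule u_ge)
      then show "u (x + y) \<le> u x + u y" by simp
    next
      fix c x assume c: "(0::real) < c"
      have "u (c *\<^sub>R x) / c \<le> q x" if "q \<in> K" for q
        using u_le[OF that, of "c *\<^sub>R x"] KS[OF that] c
        by (simp add: S_def sublinear_scale field_simps)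
      then have "u (c *\<^sub>R x) / c \<le> u x" by (rule u_ge)
      then show "u (c *\<^sub>R x) \<le> c * u x" using c by (simp add: field_simps)
    qed
    moreover have "u x \<le> p x" for x
      using u_le[OF q0, of x] KS[OF q0] by (auto simp: S_def intro: order_trans)
    ultimately show ?thesis using u_le by (auto simp: S_def P_def le_fun_def)
  qed
  ultimately obtain m where m: "m \<in> S" "\<And>a. a \<in> S \<Longrightarrow> P m a \<Longrightarrow> a = m"
    using predicate_Zorn[of S P] by blast
  have "linear m"
  proof (rule minimal_sublinear_imp_linear)
    show "sublinear m" using m(1) by (simp add: S_def)
  next
    fix q assume q: "sublinear q" "\<And>x. q x \<le> m x"
    then have "q \<in> S" using m(1) by (auto simp: S_def intro: order_trans)
    then show "q = m" using m(2) q by (simp add: P_def le_fun_def)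
  qed
  then show thesis using m(1) that by (auto simp: S_def)
qed

text \<open>
  Take \<open>r > 0\<close> not larger than the distance from \<open>x\<close> to \<open>C\<close>. The norm is at least \<open>r\<close> on the
  convex set \<open>x - C\<close>, so it can be pushed down to a sublinear functional whose linear minorants are
  at least \<open>r\<close> on \<open>x - C\<close>. Being below the norm, such a minorant is bounded.
\<close>
lemma separate_point_convex:
  fixes x :: "'a::real_normed_vector"
  assumes C: "convex C" and x: "x \<notin> closure C"
  obtains f :: "'a \<Rightarrow>\<^sub>L real" and r where "0 < r" "\<And>c. c \<in> C \<Longrightarrow> blinfun_apply f c \<le> blinfun_apply f x - r"
proof (cases "C = {}")
  case True
  then show ?thesis using that[of 1 0] by simp
next
  case False
  obtain r where r: "0 < r" "\<And>c. c \<in> C \<Longrightarrow> r \<le> dist c x"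
    using x by (force simp: closure_approachable not_less)
  have norm: "sublinear (norm :: 'a \<Rightarrow> real)"
    by (auto simp: sublinear_def norm_triangle_ineq)
  obtain q where q: "sublinear q" "\<And>y. q y \<le> norm y" "\<And>s. s \<in> (\<lambda>c. x - c) ` C \<Longrightarrow> q (- s) \<le> - r"
  proof (rule sublinear_push_down[OF norm])
    show "convex ((\<lambda>c. x - c) ` C)"
      using convex_translation[OF convex_negations[OF C], of x] by (simp add: image_image)
  qed (use False r in \<open>auto simp: dist_norm norm_minus_commute\<close>)
  obtain f where f: "linear f" "\<And>y. f y \<le> q y"
    using sublinear_dominates_linear[OF q(1)] by blast
  have "\<bar>f y\<bar> \<le> norm y" for y
    using f(2)[of y] f(2)[of "- y"] q(2)[of y] q(2)[of "- y"] linear_neg[OF f(1), of y]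
    by simp
  then have bl: "bounded_linear f"
    using f(1) by (intro bounded_linear.intro bounded_linear_axioms.intro exI[of _ 1]) auto
  have "f c \<le> f x - r" if "c \<in> C" for c
    using f(2)[of "c - x"] q(3)[of "x - c"] that linear_diff[OF f(1), of c x] by simp
  then show ?thesis
    using that[of r "Blinfun f"] r(1) by (simp add: bounded_linear_Blinfun_apply[OF bl])
qed

section \<open>Basic neighbourhoods in the weak and weak* topologies\<close>

text \<open>
  Both the weak and the weak* topology are pulled back from a product of real lines, so this
  serves for both.
\<close>
lemma openin_pullback_pointwise_box:
  fixes g :: "'b \<Rightarrow> 'i \<Rightarrow> real"
  assumes "openin (pullback_topology UNIV g euclidean) U" and "u \<in> U"
  obtains F \<delta> where "finite F" "0 < \<delta>" "\<And>v. (\<And>i. i \<in> F \<Longrightarrow> \<bar>g v i - g u i\<bar> < \<delta>) \<Longrightarrow> v \<in> U"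
proof -
  obtain V where V: "open V" "U = g -` V"
    using assms(1) by (auto simp: openin_pullback_topology)
  then have "openin (product_topology (\<lambda>i. euclidean) UNIV) V" "g u \<in> V"
    using assms(2) by (auto simp: open_fun_def)
  from product_topology_open_contains_basis[OF this]
  obtain X where X: "g u \<in> (\<Pi>\<^sub>E i\<in>UNIV. X i)" "\<And>i. open (X i)"
      "finite {i. X i \<noteq> UNIV}" "(\<Pi>\<^sub>E i\<in>UNIV. X i) \<subseteq> V"
    by auto
  have "\<exists>e>0. \<forall>t. \<bar>t - g u i\<bar> < e \<longrightarrow> t \<in> X i" for i
    using X(1,2) by (auto simp: open_dist dist_real_def PiE_iff)
  then obtain e where e: "\<And>i. 0 < e i" "\<And>i t. \<bar>t - g u i\<bar> < e i \<Longrightarrow> t \<in> X i"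
    by metis
  define \<delta> where "\<delta> = Min (insert 1 (e ` {i. X i \<noteq> UNIV}))"
  show thesis
  proof
    show "finite {i. X i \<noteq> UNIV}" by (rule X(3))
    show "0 < \<delta>" using X(3) e(1) by (simp add: \<delta>_def)
  next
    fix v assume v: "\<And>i. i \<in> {i. X i \<noteq> UNIV} \<Longrightarrow> \<bar>g v i - g u i\<bar> < \<delta>"
    have "g v i \<in> X i" for i
    proof (cases "X i = UNIV")
      case False
      then have "\<delta> \<le> e i" using X(3) by (auto simp: \<delta>_def)
      with v[of i] False show ?thesis by (intro e(2)) auto
    qed simp
    then have "g v \<in> V" using X(4) by (auto simp: PiE_iff)
    then show "v \<in> U" by (simp add: V(2))
  qed
qed

lemma weakly_open_contains_box:
  fixes U :: "'a::real_normed_vector set"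
  assumes "openin weak_topology U" and "x \<in> U"
  obtains F :: "('a \<Rightarrow>\<^sub>L real) set" and \<delta> where "finite F" "0 < \<delta>"
    "\<And>y. (\<And>f. f \<in> F \<Longrightarrow> \<bar>blinfun_apply f (y - x)\<bar> < \<delta>) \<Longrightarrow> y \<in> U"
proof -
  from openin_pullback_pointwise_box[OF assms(1)[unfolded weak_topology_def] assms(2)]
  obtain F :: "('a \<Rightarrow>\<^sub>L real) set" and \<delta> where "finite F" "0 < \<delta>"
    "\<And>y. (\<And>f. f \<in> F \<Longrightarrow> \<bar>blinfun_apply f y - blinfun_apply f x\<bar> < \<delta>) \<Longrightarrow> y \<in> U"
    by blast
  then show thesis using that by (simp add: blinfun.diff_right)
qed

lemma weak_star_closure_iff:
  fixes u :: "'b::real_normed_vector \<Rightarrow>\<^sub>L real"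
  shows "u \<in> weak_star_topology closure_of S \<longleftrightarrow>
     (\<forall>F \<delta>. finite F \<longrightarrow> 0 < \<delta> \<longrightarrow>
        (\<exists>s\<in>S. \<forall>f\<in>F. \<bar>blinfun_apply s f - blinfun_apply u f\<bar> < \<delta>))"
    (is "?L \<longleftrightarrow> ?R")
proof
  assume L: ?L
  show ?R
  proof (intro allI impI)
    fix F :: "'b set" and \<delta> :: real assume F: "finite F" "0 < \<delta>"
    define T where "T = {v :: 'b \<Rightarrow>\<^sub>L real. \<forall>f\<in>F. blinfun_apply v f \<in> ball (blinfun_apply u f) \<delta>}"
    have "openin weak_star_topology T"
      unfolding T_def using F(1) by (intro strong_operator_topology_basis) auto
    moreover have "u \<in> T" using F by (simp add: T_def)
    ultimately obtain s where "s \<in> S" "s \<in> T" using L by (auto simp: in_closure_of)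
    then show "\<exists>s\<in>S. \<forall>f\<in>F. \<bar>blinfun_apply s f - blinfun_apply u f\<bar> < \<delta>"
      by (auto simp: T_def dist_real_def abs_minus_commute)
  qed
next
  assume R: ?R
  show ?L
    unfolding in_closure_of
  proof (intro conjI allI impI)
    show "u \<in> topspace weak_star_topology" by (simp add: strong_operator_topology_topspace)
  next
    fix T assume "u \<in> T \<and> openin weak_star_topology T"
    then obtain F \<delta> where F: "finite F" "0 < \<delta>"
        "\<And>v. (\<And>f. f \<in> F \<Longrightarrow> \<bar>blinfun_apply v f - blinfun_apply u f\<bar> < \<delta>) \<Longrightarrow> v \<in> T"
      using openin_pullback_pointwise_box[of blinfun_apply T u]
      by (auto simp: strong_operator_topology_def)
    with R show "\<exists>y. y \<in> S \<and> y \<in> T" by meson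
  qed
qed

lemma bidual_embedding_apply [simp]:
  "blinfun_apply (bidual_embedding x) f = blinfun_apply f x"
  by transfer simp

lemma bidual_embedding_closure_iff:
  fixes u :: "('a::real_normed_vector \<Rightarrow>\<^sub>L real) \<Rightarrow>\<^sub>L real"
  shows "u \<in> weak_star_topology closure_of (bidual_embedding ` S) \<longleftrightarrow>
     (\<forall>F \<delta>. finite F \<longrightarrow> 0 < \<delta> \<longrightarrow>
        (\<exists>s\<in>S. \<forall>f\<in>F. \<bar>blinfun_apply f s - blinfun_apply u f\<bar> < \<delta>))"
  by (simp add: weak_star_closure_iff)

text \<open>
  The part of the Banach--Alaoglu theorem that is needed. The evaluations of the dual at the
  points \<open>a n\<close> lie in a product of compact intervals, so they have a cluster point there by
  Tychonoff's theorem. It agrees approximately with some \<open>a n\<close> on any finitely many functionals,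
  hence it is again linear and bounded, that is, an element of the bidual.
\<close>
lemma bounded_sequence_weak_star_cluster_point:
  fixes a :: "nat \<Rightarrow> 'a::real_normed_vector"
  assumes "bounded (range a)"
  obtains u :: "('a \<Rightarrow>\<^sub>L real) \<Rightarrow>\<^sub>L real" where
    "\<And>F \<delta>. finite F \<Longrightarrow> 0 < \<delta> \<Longrightarrow>
       \<exists>\<^sub>F n in sequentially. \<forall>f\<in>F. \<bar>blinfun_apply f (a n) - blinfun_apply u f\<bar> < \<delta>"
proof -
  obtain R where R: "\<And>n. norm (a n) \<le> R" using assms by (auto simp: bounded_iff)
  define g where "g n f = blinfun_apply f (a n)" for n and f :: "'a \<Rightarrow>\<^sub>L real"
  define K where "K = (\<Pi>\<^sub>E f\<in>(UNIV :: ('a \<Rightarrow>\<^sub>L real) set). cball (0::real) (norm f * R))"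
  have "compact K"
    unfolding K_def
    by (metis compact_cball compactin_PiE compactin_euclidean_iff euclidean_product_topology)
  moreover have gK: "g n \<in> K" for n
  proof -
    have "\<bar>g n f\<bar> \<le> norm f * R" for f
      using norm_blinfun[of f "a n"] mult_left_mono[OF R[of n], of "norm f"] by (simp add: g_def)
    then show ?thesis by (auto simp: K_def PiE_iff)
  qed
  ultimately obtain w where w: "w \<in> K" "inf (nhds w) (filtermap g sequentially) \<noteq> bot"
    unfolding compact_filter
    by (metis (mono_tags, lifting) always_eventually eventually_filtermap filtermap_bot_iff
        sequentially_bot)
  have freq: "\<exists>\<^sub>F n in sequentially. \<forall>f\<in>F. \<bar>g n f - w f\<bar> < \<delta>" if "finite F" "0 < \<delta>" for F \<delta>
  proof (rule ccontr)
    assume "\<not> ?thesis"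
    then have ev: "\<forall>\<^sub>F v in filtermap g sequentially. \<not> (\<forall>f\<in>F. \<bar>v f - w f\<bar> < \<delta>)"
      by (simp add: not_frequently eventually_filtermap)
    have "open {v. \<forall>f\<in>F. v f \<in> ball (w f) \<delta>}"
      using product_topology_basis'[of F "\<lambda>f. ball (w f) \<delta>" "\<lambda>f. f"] that by simp
    then have "\<forall>\<^sub>F v in nhds w. v \<in> {v. \<forall>f\<in>F. v f \<in> ball (w f) \<delta>}"
      using that by (intro eventually_nhds_in_open) auto
    then have "\<forall>\<^sub>F v in nhds w. \<forall>f\<in>F. \<bar>v f - w f\<bar> < \<delta>"
      by eventually_elim (auto simp: dist_real_def abs_minus_commute)
    with ev have "\<forall>\<^sub>F v in inf (nhds w) (filtermap g sequentially). False"
      by (auto simp: eventually_inf)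
    with w(2) show False by (simp add: trivial_limit_def)
  qed
  have close: "\<exists>n. \<forall>f\<in>F. \<bar>g n f - w f\<bar> < \<delta>" if "finite F" "0 < \<delta>" for F \<delta>
    using frequently_ex[OF freq[OF that]] .
  have "linear w"
  proof (rule linearI)
    fix f h
    have "\<bar>w (f + h) - (w f + w h)\<bar> \<le> 0"
    proof (rule field_le_epsilon)
      fix e :: real assume "0 < e"
      then obtain n where "\<forall>k\<in>{f, h, f + h}. \<bar>g n k - w k\<bar> < e / 3"
        using close[of "{f, h, f + h}" "e / 3"] by auto
      moreover have "g n (f + h) = g n f + g n h" by (simp add: g_def blinfun.add_left)
      ultimately show "\<bar>w (f + h) - (w f + w h)\<bar> \<le> 0 + e" by (simp add: abs_if split: if_splits)
    qed
    then show "w (f + h) = w f + w h" by simp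
  next
    fix c f
    have "\<bar>w (c *\<^sub>R f) - c * w f\<bar> \<le> 0"
    proof (rule field_le_epsilon)
      fix e :: real assume e: "0 < e"
      \<comment> \<open>The two approximation errors enter with total weight \<open>1 + \<bar>c\<bar>\<close>.\<close>
      define d where "d = e / (1 + \<bar>c\<bar>)"
      have d: "0 < d" "(1 + \<bar>c\<bar>) * d = e" using e by (auto simp: d_def)
      obtain n where n: "\<forall>k\<in>{f, c *\<^sub>R f}. \<bar>g n k - w k\<bar> < d"
        using close[of "{f, c *\<^sub>R f}" d] d by auto
      have "w (c *\<^sub>R f) - c * w f = c * (g n f - w f) - (g n (c *\<^sub>R f) - w (c *\<^sub>R f))"
        by (simp add: g_def blinfun.scaleR_left algebra_simps)
      also have "\<bar>\<dots>\<bar> \<le> \<bar>c * (g n f - w f)\<bar> + \<bar>g n (c *\<^sub>R f) - w (c *\<^sub>R f)\<bar>"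
        by (rule abs_triangle_ineq4)
      also have "\<dots> \<le> \<bar>c\<bar> * d + d"
        using n by (intro add_mono) (auto simp: abs_mult intro: mult_left_mono)
      finally show "\<bar>w (c *\<^sub>R f) - c * w f\<bar> \<le> 0 + e" using d(2) by (simp add: algebra_simps)
    qed
    then show "w (c *\<^sub>R f) = c *\<^sub>R w f" by simp
  qed
  moreover have "\<bar>w f\<bar> \<le> norm f * R" for f using w(1) by (auto simp: K_def PiE_iff)
  ultimately have "bounded_linear w"
    by (intro bounded_linear.intro bounded_linear_axioms.intro exI[of _ R]) auto
  then show thesis
    using that[of "Blinfun w"] freq by (simp add: bounded_linear_Blinfun_apply g_def)
qed

section \<open>Denting points\<close>

text \<open>
  A functional that separates \<open>x\<close> from \<open>convex hull (A - ball x e)\<close> cuts off a slice of \<open>A\<close> that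
  lies inside the ball.
\<close>
lemma denting_point_slice:
  assumes "denting_point A x" and "0 < e"
  obtains f :: "'a::real_normed_vector \<Rightarrow>\<^sub>L real" and r where "0 < r"
    "\<And>y. y \<in> A \<Longrightarrow> blinfun_apply f x - r < blinfun_apply f y \<Longrightarrow> dist x y < e"
proof -
  have "x \<notin> closure (convex hull (A - ball x e))"
    using assms by (auto simp: denting_point_def)
  then obtain f :: "'a \<Rightarrow>\<^sub>L real" and r where fr: "0 < r"
      "\<And>c. c \<in> convex hull (A - ball x e) \<Longrightarrow> blinfun_apply f c \<le> blinfun_apply f x - r"
    using separate_point_convex[OF convex_convex_hull] by blast
  show thesis
  proof (rule that[OF fr(1)])
    fix y assume y: "y \<in> A" "blinfun_apply f x - r < blinfun_apply f y"
    show "dist x y < e"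
    proof (rule ccontr)
      assume "\<not> dist x y < e"
      then have "y \<in> convex hull (A - ball x e)" using y(1) by (auto intro: hull_inc)
      with fr(2) y(2) show False by fastforce
    qed
  qed
qed

lemma continuous_map_weak_topology_blinfun_apply:
  fixes f :: "'a::real_normed_vector \<Rightarrow>\<^sub>L real"
  shows "continuous_map weak_topology euclideanreal (blinfun_apply f)"
  using continuous_map_weak_topology_iff[of weak_topology "id :: 'a \<Rightarrow> 'a"] by simp

lemma openin_weak_topology_slice:
  fixes f :: "'a::real_normed_vector \<Rightarrow>\<^sub>L real"
  shows "openin weak_topology {y. c < blinfun_apply f y}"
proof -
  have "openin weak_topology {y \<in> topspace weak_topology. blinfun_apply f y \<in> {c<..}}"
    by (rule openin_continuous_map_preimage[OF continuous_map_weak_topology_blinfun_apply]) simp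
  then show ?thesis by simp
qed

lemma denting_point_imp_point_of_continuity:
  fixes x :: "'a::real_normed_vector"
  assumes d: "denting_point A x"
  shows "point_of_continuity A x"
  unfolding point_of_continuity_def topcontinuous_at_def
proof (intro conjI allI impI)
  show "x \<in> topspace (subtopology weak_topology A)" using d by (simp add: denting_point_def)
  show "id \<in> topspace (subtopology weak_topology A) \<rightarrow> topspace (top_of_set A)" by auto
next
  fix V assume "openin (top_of_set A) V \<and> id x \<in> V"
  then obtain e where e: "0 < e" "\<And>y. y \<in> A \<Longrightarrow> dist x y < e \<Longrightarrow> y \<in> V"
    by (auto simp: openin_euclidean_subtopology_iff dist_commute)
  from denting_point_slice[OF d e(1)] obtain f :: "'a \<Rightarrow>\<^sub>L real" and r where fr: "0 < r"
    "\<And>y. y \<in> A \<Longrightarrow> blinfun_apply f x - r < blinfun_apply f y \<Longrightarrow> dist x y < e" by blast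
  show "\<exists>U. openin (subtopology weak_topology A) U \<and> x \<in> U \<and> (\<forall>y\<in>U. id y \<in> V)"
  proof (intro exI conjI)
    show "openin (subtopology weak_topology A) ({y. blinfun_apply f x - r < blinfun_apply f y} \<inter> A)"
      using openin_weak_topology_slice by (auto simp: openin_subtopology)
  qed (use d e fr in \<open>auto simp: denting_point_def\<close>)
qed

lemma point_of_continuity_box:
  fixes x :: "'a::real_normed_vector"
  assumes pc: "point_of_continuity A x" and x: "x \<in> A" and e: "0 < e"
  obtains F :: "('a \<Rightarrow>\<^sub>L real) set" and \<delta> where "finite F" "0 < \<delta>"
    "\<And>y. y \<in> A \<Longrightarrow> (\<And>f. f \<in> F \<Longrightarrow> \<bar>blinfun_apply f (y - x)\<bar> < \<delta>) \<Longrightarrow> dist x y < e"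
proof -
  have "openin (top_of_set A) (A \<inter> ball x e) \<and> id x \<in> A \<inter> ball x e"
    using x e by (simp add: openin_open_Int)
  then obtain U where U: "openin (subtopology weak_topology A) U" "x \<in> U"
      "\<And>y. y \<in> U \<Longrightarrow> y \<in> A \<inter> ball x e"
    using pc unfolding point_of_continuity_def topcontinuous_at_def by (metis id_apply)
  then obtain T where T: "openin weak_topology T" "U = T \<inter> A"
    by (auto simp: openin_subtopology)
  then obtain F :: "('a \<Rightarrow>\<^sub>L real) set" and \<delta> where "finite F" "0 < \<delta>"
    "\<And>y. (\<And>f. f \<in> F \<Longrightarrow> \<bar>blinfun_apply f (y - x)\<bar> < \<delta>) \<Longrightarrow> y \<in> T"
    using weakly_open_contains_box[of T x] U(2) by blast
  with T(2) U(3) show thesis by (intro that[of F \<delta>]) auto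
qed

lemma tendsto_imp_limitin_weak_topology:
  fixes x :: "'a::real_normed_vector"
  assumes "(a \<longlongrightarrow> x) F"
  shows "limitin weak_topology a x F"
proof -
  have "continuous_map euclidean weak_topology (\<lambda>x::'a. x)"
    by (auto simp: continuous_map_weak_topology_iff intro!: continuous_intros)
  then show ?thesis
    using continuous_map_limit[of euclidean weak_topology "\<lambda>x. x" a x F] assms
    by (simp add: comp_def)
qed

lemma limitin_weak_topology_imp_tendsto:
  fixes f :: "'a::real_normed_vector \<Rightarrow>\<^sub>L real"
  assumes "limitin weak_topology a x F"
  shows "((\<lambda>n. blinfun_apply f (a n)) \<longlongrightarrow> blinfun_apply f x) F"
proof -
  from continuous_map_limit[OF continuous_map_weak_topology_blinfun_apply assms] show ?thesis by (simp add: comp_def)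
qed

text \<open>
  If \<open>a n + a' n\<close> is close to \<open>2 *\<^sub>R x\<close>, then \<open>a n\<close> or \<open>a' n\<close> lies in a given slice around \<open>x\<close>,
  hence is close to \<open>x\<close> in norm if the slice is small; but then so is the other one. Therefore
  \<open>a\<close> even converges in norm.
\<close>
lemma denting_point_imp_weakly_strongly_extreme_point:
  fixes x :: "'a::real_normed_vector"
  assumes d: "denting_point A x"
  shows "weakly_strongly_extreme_point A x"
  unfolding weakly_strongly_extreme_point_def
proof (intro conjI allI impI)
  show "x \<in> A" using d by (simp add: denting_point_def)
next
  fix a a' :: "nat \<Rightarrow> 'a"
  assume A: "range a \<subseteq> A" "range a' \<subseteq> A" and lim: "(\<lambda>n. a n + a' n) \<longlonglongrightarrow> 2 *\<^sub>R x"
  have "a \<longlonglongrightarrow> x"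
  proof (rule tendstoI)
    fix e :: real assume e: "0 < e"
    then have e2: "0 < e / 2" by simp
    from denting_point_slice[OF d e2] obtain f :: "'a \<Rightarrow>\<^sub>L real" and r where fr: "0 < r"
      "\<And>y. y \<in> A \<Longrightarrow> blinfun_apply f x - r < blinfun_apply f y \<Longrightarrow> dist x y < e / 2" by blast
    have "(\<lambda>n. blinfun_apply f (a n + a' n)) \<longlonglongrightarrow> blinfun_apply f (2 *\<^sub>R x)"
      by (intro tendsto_intros lim)
    moreover have "2 * blinfun_apply f x - 2 * r < blinfun_apply f (2 *\<^sub>R x)"
      using fr(1) by (simp add: blinfun.scaleR_right)
    ultimately have "\<forall>\<^sub>F n in sequentially. 2 * blinfun_apply f x - 2 * r < blinfun_apply f (a n + a' n)"
      by (rule order_tendstoD)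
    moreover have "\<forall>\<^sub>F n in sequentially. dist (a n + a' n) (2 *\<^sub>R x) < e / 2"
      using lim e2 by (rule tendstoD)
    ultimately show "\<forall>\<^sub>F n in sequentially. dist (a n) x < e"
    proof eventually_elim
      case (elim n)
      have mem: "a n \<in> A" "a' n \<in> A" using A by auto
      have "blinfun_apply f x - r < blinfun_apply f (a n) \<or> blinfun_apply f x - r < blinfun_apply f (a' n)"
        using elim(1) by (auto simp: blinfun.add_right)
      then consider "dist x (a n) < e / 2" | "dist x (a' n) < e / 2"
        using fr(2) mem by blast
      then show ?case
      proof cases
        case 1 then show ?thesis using e by (simp add: dist_commute)
      next
        case 2
        have "a n - x = (a n + a' n - 2 *\<^sub>R x) + (x - a' n)" by (simp add: scaleR_2)
        then have "dist (a n) x \<le> dist (a n + a' n) (2 *\<^sub>R x) + dist x (a' n)"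
          unfolding dist_norm by (metis norm_triangle_ineq)
        with 2 elim(2) show ?thesis by simp
      qed
    qed
  qed
  then show "limitin weak_topology a x sequentially" by (rule tendsto_imp_limitin_weak_topology)
qed

section \<open>Weakly strongly extreme points are preserved\<close>

lemma bidual_embedding_linear: "linear bidual_embedding"
  by (rule linearI; rule blinfun_eqI)
     (simp_all add: blinfun.add_left blinfun.add_right blinfun.scaleR_left blinfun.scaleR_right)

lemma bidual_embedding_inj: "inj bidual_embedding"
proof (rule injI)
  fix x y :: 'a assume eq: "bidual_embedding x = bidual_embedding y"
  show "x = y"
  proof (rule ccontr)
    assume "x \<noteq> y"
    then have "x \<notin> closure {y}" by simp
    then obtain f :: "'a \<Rightarrow>\<^sub>L real" and r where "0 < r" "blinfun_apply f y \<le> blinfun_apply f x - r"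
      using separate_point_convex[of "{y}" x] by (metis convex_singleton singletonI)
    then show False using arg_cong[OF eq, of "\<lambda>u. blinfun_apply u f"] by simp
  qed
qed

lemma bidual_embedding_in_closure:
  "a \<in> A \<Longrightarrow> bidual_embedding a \<in> weak_star_topology closure_of (bidual_embedding ` A)"
  by (force simp: bidual_embedding_closure_iff)

text \<open>
  A segment in \<open>A\<close> around \<open>x\<close> is mapped to a non-degenerate segment of the weak* closure, so
  extremality in the bidual implies extremality in \<open>A\<close>.
\<close>
lemma preserved_extreme_pointI:
  assumes x: "x \<in> A" and ext: "bidual_embedding x extreme_point_of
       (weak_star_topology closure_of (bidual_embedding ` A))"
  shows "preserved_extreme_point A x"
proof -
  have "x \<notin> open_segment a b" if ab: "a \<in> A" "b \<in> A" for a b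
  proof
    assume "x \<in> open_segment a b"
    then have "bidual_embedding x \<in> open_segment (bidual_embedding a) (bidual_embedding b)"
      using injD[OF bidual_embedding_inj, of a b]
      by (auto simp: in_segment linear_add[OF bidual_embedding_linear]
          linear_scale[OF bidual_embedding_linear])
    with ext ab bidual_embedding_in_closure show False unfolding extreme_point_of_def by blast
  qed
  with x ext show ?thesis by (simp add: preserved_extreme_point_def extreme_point_of_def)
qed

text \<open>
  Weak strong extremality speaks of midpoints. A combination with weight \<open>t \<le> 1 / 2\<close> is the midpoint
  of \<open>c\<close> and of \<open>(1 - 2 * t) *\<^sub>R c + (2 * t) *\<^sub>R b\<close>, which belongs to \<open>A\<close> as well.
\<close>
lemma weakly_strongly_extreme_point_not_in_closure:
  fixes x :: "'a::real_normed_vector" and f :: "'a \<Rightarrow>\<^sub>L real"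
  assumes wse: "weakly_strongly_extreme_point A x" and A: "convex A"
    and t: "0 \<le> t" "t \<le> 1 / 2" and C: "C \<subseteq> A"
    and h: "0 < h" "\<And>c. c \<in> C \<Longrightarrow> blinfun_apply f x + h \<le> blinfun_apply f c"
  shows "x \<notin> closure {(1 - t) *\<^sub>R c + t *\<^sub>R b | c b. c \<in> C \<and> b \<in> A}"
proof
  assume "x \<in> closure {(1 - t) *\<^sub>R c + t *\<^sub>R b | c b. c \<in> C \<and> b \<in> A}"
  then obtain y where y: "\<And>n::nat. \<exists>c b. y n = (1 - t) *\<^sub>R c + t *\<^sub>R b \<and> c \<in> C \<and> b \<in> A"
      "y \<longlonglongrightarrow> x"
    unfolding closure_sequential by auto
  then obtain c b where cb: "\<And>n. y n = (1 - t) *\<^sub>R c n + t *\<^sub>R b n" "\<And>n. c n \<in> C" "\<And>n. b n \<in> A"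
    by metis
  \<comment> \<open>This choice gives \<open>c n + a' n = 2 *\<^sub>R y n\<close>.\<close>
  define a' where "a' n = (1 - 2 * t) *\<^sub>R c n + (2 * t) *\<^sub>R b n" for n
  have "range a' \<subseteq> A"
    using cb C t by (auto simp: a'_def intro!: convexD[OF A])
  moreover have "range c \<subseteq> A" using cb(2) C by auto
  moreover have "(\<lambda>n. c n + a' n) \<longlonglongrightarrow> 2 *\<^sub>R x"
  proof -
    have "c n + a' n = 2 *\<^sub>R y n" for n
      unfolding cb(1) a'_def by (simp add: algebra_simps scaleR_2)
    then show ?thesis using tendsto_scaleR[OF tendsto_const y(2), of 2] by simp
  qed
  ultimately have "limitin weak_topology c x sequentially"
    using wse by (auto simp: weakly_strongly_extreme_point_def)
  then have "(\<lambda>n. blinfun_apply f (c n)) \<longlonglongrightarrow> blinfun_apply f x"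
    by (rule limitin_weak_topology_imp_tendsto)
  then have "blinfun_apply f x + h \<le> blinfun_apply f x"
    by (rule LIMSEQ_le_const) (use h cb in auto)
  with h(1) show False by simp
qed

text \<open>
  If \<open>u\<close> differs from \<open>x\<close>, some functional \<open>f\<close> is larger at \<open>u\<close> than at \<open>x\<close>, and points of
  \<open>A\<close> that approximate \<open>u\<close> can be taken from the convex set \<open>C\<close> where \<open>f\<close> exceeds \<open>f x\<close> by at
  least a fixed amount \<open>h\<close>. So \<open>x\<close> is in the weak closure of the convex
  set \<open>D = (1 - t) C + t A\<close>. Separation shows that it is then in the norm closure of
  \<open>D\<close>, which is impossible by the previous lemma.
\<close>
lemma weakly_strongly_extreme_point_bidual:
  fixes x :: "'a::real_normed_vector"
  assumes wse: "weakly_strongly_extreme_point A x" and A: "convex A"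
    and t: "0 \<le> t" "t \<le> 1 / 2"
    and u: "u \<in> weak_star_topology closure_of (bidual_embedding ` A)"
    and v: "v \<in> weak_star_topology closure_of (bidual_embedding ` A)"
    and x: "bidual_embedding x = (1 - t) *\<^sub>R u + t *\<^sub>R v"
  shows "u = bidual_embedding x"
proof (rule ccontr)
  assume "u \<noteq> bidual_embedding x"
  then obtain k where "blinfun_apply u k \<noteq> blinfun_apply k x"
    using blinfun_eqI[of u "bidual_embedding x"] by auto
  then obtain f where f: "blinfun_apply f x < blinfun_apply u f"
  proof (cases "blinfun_apply k x < blinfun_apply u k")
    case False
    with \<open>blinfun_apply u k \<noteq> blinfun_apply k x\<close> show ?thesis
      by (intro that[of "- k"]) (simp add: blinfun.minus_left blinfun.minus_right)
  qed
  define h where "h = (blinfun_apply u f - blinfun_apply f x) / 2"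
  have h: "0 < h" "blinfun_apply u f = blinfun_apply f x + 2 * h" using f by (auto simp: h_def field_simps)
  define C where "C = A \<inter> {c. blinfun_apply f x + h \<le> blinfun_apply f c}"
  define D where "D = {(1 - t) *\<^sub>R c + t *\<^sub>R b | c b. c \<in> C \<and> b \<in> A}"
  have "linear (blinfun_apply f)" by (simp add: bounded_linear.linear blinfun.bounded_linear_right)
  then have "convex (blinfun_apply f -` {blinfun_apply f x + h..})"
    by (rule convex_linear_vimage) (rule convex_real_interval)
  then have C: "convex C"
    unfolding C_def using A by (intro convex_Int) (auto simp: vimage_def)
  have "D = (\<Union>c\<in>(\<lambda>c. (1 - t) *\<^sub>R c) ` C. \<Union>b\<in>(\<lambda>b. t *\<^sub>R b) ` A. {c + b})"
    unfolding D_def by auto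
  then have "convex D"
    by (simp only:) (intro convex_sums convex_scaling C A)
  moreover have "x \<notin> closure D"
    unfolding D_def
    by (rule weakly_strongly_extreme_point_not_in_closure[OF wse A t _ h(1), where f = f])
       (auto simp: C_def)
  ultimately obtain g :: "'a \<Rightarrow>\<^sub>L real" and r where g: "0 < r"
      "\<And>d. d \<in> D \<Longrightarrow> blinfun_apply g d \<le> blinfun_apply g x - r"
    using separate_point_convex by blast
  define \<delta> where "\<delta> = min h r"
  have \<delta>: "0 < \<delta>" "\<delta> \<le> h" "\<delta> \<le> r" using h g by (auto simp: \<delta>_def)
  obtain a where a: "a \<in> A" "\<bar>blinfun_apply f a - blinfun_apply u f\<bar> < \<delta>"
      "\<bar>blinfun_apply g a - blinfun_apply u g\<bar> < \<delta>"
    using u[unfolded bidual_embedding_closure_iff, rule_format, of "{f, g}" \<delta>] \<delta>(1) by auto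
  obtain b where b: "b \<in> A" "\<bar>blinfun_apply g b - blinfun_apply v g\<bar> < \<delta>"
    using v[unfolded bidual_embedding_closure_iff, rule_format, of "{g}" \<delta>] \<delta>(1) by auto
  have "a \<in> C" using a(1,2) h \<delta> by (auto simp: C_def)
  then have "blinfun_apply g ((1 - t) *\<^sub>R a + t *\<^sub>R b) \<le> blinfun_apply g x - r"
    using b(1) by (intro g(2)) (auto simp: D_def)
  moreover have "blinfun_apply g x = (1 - t) * blinfun_apply u g + t * blinfun_apply v g"
    using arg_cong[OF x, of "\<lambda>w. blinfun_apply w g"]
    by (simp add: blinfun.add_left blinfun.scaleR_left)
  moreover have "blinfun_apply g ((1 - t) *\<^sub>R a + t *\<^sub>R b)
      = (1 - t) * blinfun_apply g a + t * blinfun_apply g b"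
    by (simp add: blinfun.add_right blinfun.scaleR_right)
  ultimately have "(1 - t) * (blinfun_apply g a - blinfun_apply u g)
      + t * (blinfun_apply g b - blinfun_apply v g) \<le> - r"
    by (simp add: right_diff_distrib)
  moreover have "(1 - t) * (- \<delta>) < (1 - t) * (blinfun_apply g a - blinfun_apply u g)"
    using a(3) t by (intro mult_strict_left_mono) auto
  moreover have "t * (- \<delta>) \<le> t * (blinfun_apply g b - blinfun_apply v g)"
    using b(2) t by (intro mult_left_mono) auto
  ultimately show False using \<delta>(3) by (simp add: algebra_simps)
qed

text \<open>
  One of the two weights of a point of an open segment is at most \<open>1 / 2\<close>; exchanging the
  endpoints if necessary makes it the weight of the second endpoint.
\<close>
lemma weakly_strongly_extreme_point_imp_preserved_extreme_point:
  fixes x :: "'a::real_normed_vector"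
  assumes wse: "weakly_strongly_extreme_point A x" and A: "convex A"
  shows "preserved_extreme_point A x"
proof -
  let ?K = "weak_star_topology closure_of (bidual_embedding ` A)"
  have x: "x \<in> A" using wse by (simp add: weakly_strongly_extreme_point_def)
  have "bidual_embedding x \<notin> open_segment u v" if uv: "u \<in> ?K" "v \<in> ?K" for u v
  proof
    assume "bidual_embedding x \<in> open_segment u v"
    then obtain t where t: "u \<noteq> v" "0 < t" "t < 1"
      "bidual_embedding x = (1 - t) *\<^sub>R u + t *\<^sub>R v"
      by (auto simp: in_segment)
    show False
    proof (cases "t \<le> 1 / 2")
      case True
      then have u: "u = bidual_embedding x"
        using weakly_strongly_extreme_point_bidual[OF wse A _ _ uv t(4)] t(2) by linarith
      have "t *\<^sub>R (u - v) = u - ((1 - t) *\<^sub>R u + t *\<^sub>R v)" by (simp add: algebra_simps)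
      also have "\<dots> = 0" using trans[OF u t(4)] by (metis right_minus_eq)
      finally show False using t(1,2) by simp
    next
      case False
      have swap: "bidual_embedding x = (1 - (1 - t)) *\<^sub>R v + (1 - t) *\<^sub>R u"
        unfolding t(4) by simp
      from False have v: "v = bidual_embedding x"
        using weakly_strongly_extreme_point_bidual[OF wse A _ _ uv(2,1) swap] t(3) by linarith
      have "(1 - t) *\<^sub>R (v - u) = v - ((1 - t) *\<^sub>R u + t *\<^sub>R v)" by (simp add: algebra_simps)
      also have "\<dots> = 0" using trans[OF v t(4)] by (metis right_minus_eq)
      finally show False using t(1,3) by simp
    qed
  qed
  then show ?thesis
    using x by (intro preserved_extreme_pointI) (auto simp: extreme_point_of_def bidual_embedding_in_closure)
qed

section \<open>Preserved extreme points of continuity are denting\<close>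

lemma convex_hull_Un_subset:
  assumes C: "convex C1" "convex C2" "C1 \<noteq> {}" "C2 \<noteq> {}"
  shows "convex hull (C1 \<union> C2)
    \<subseteq> {(1 - t) *\<^sub>R a + t *\<^sub>R b | t a b. 0 \<le> t \<and> t \<le> 1 \<and> a \<in> C1 \<and> b \<in> C2}" (is "_ \<subseteq> ?W")
proof (rule hull_minimal)
  obtain c1 c2 where c: "c1 \<in> C1" "c2 \<in> C2" using C by blast
  have "a \<in> ?W" if "a \<in> C1" for a
    using that c(2) by (intro CollectI exI[of _ 0] exI[of _ a] exI[of _ c2]) simp
  moreover have "b \<in> ?W" if "b \<in> C2" for b
    using that c(1) by (intro CollectI exI[of _ 1] exI[of _ c1] exI[of _ b]) simp
  ultimately show "C1 \<union> C2 \<subseteq> ?W" by blast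
  show "convex ?W"
  proof (rule convexI)
    fix w w' and \<alpha> \<beta> :: real
    assume "w \<in> ?W" "w' \<in> ?W" and \<alpha>\<beta>: "0 \<le> \<alpha>" "0 \<le> \<beta>" "\<alpha> + \<beta> = 1"
    then obtain t a b t' a' b' where
      w: "w = (1 - t) *\<^sub>R a + t *\<^sub>R b" "0 \<le> t" "t \<le> 1" "a \<in> C1" "b \<in> C2" and
      w': "w' = (1 - t') *\<^sub>R a' + t' *\<^sub>R b'" "0 \<le> t'" "t' \<le> 1" "a' \<in> C1" "b' \<in> C2"
      by auto
    obtain a'' where a'': "a'' \<in> C1" "(\<alpha> * (1 - t)) *\<^sub>R a + (\<beta> * (1 - t')) *\<^sub>R a'
        = (\<alpha> * (1 - t) + \<beta> * (1 - t')) *\<^sub>R a''"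
      using convex_scaled_sum[OF C(1) w(4) w'(4), of "\<alpha> * (1 - t)" "\<beta> * (1 - t')"] w w' \<alpha>\<beta> by auto
    obtain b'' where b'': "b'' \<in> C2" "(\<alpha> * t) *\<^sub>R b + (\<beta> * t') *\<^sub>R b' = (\<alpha> * t + \<beta> * t') *\<^sub>R b''"
      using convex_scaled_sum[OF C(2) w(5) w'(5), of "\<alpha> * t" "\<beta> * t'"] w w' \<alpha>\<beta> by auto
    have weight: "\<alpha> * (1 - t) + \<beta> * (1 - t') = 1 - (\<alpha> * t + \<beta> * t')"
      using \<alpha>\<beta>(3) by (simp add: algebra_simps)
    have "\<alpha> *\<^sub>R w + \<beta> *\<^sub>R w' = ((\<alpha> * (1 - t)) *\<^sub>R a + (\<beta> * (1 - t')) *\<^sub>R a')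
        + ((\<alpha> * t) *\<^sub>R b + (\<beta> * t') *\<^sub>R b')"
      unfolding w(1) w'(1) by (simp add: scaleR_add_right)
    also have "\<dots> = (1 - (\<alpha> * t + \<beta> * t')) *\<^sub>R a'' + (\<alpha> * t + \<beta> * t') *\<^sub>R b''"
      unfolding a''(2) b''(2) weight ..
    finally have eq: "\<alpha> *\<^sub>R w + \<beta> *\<^sub>R w' = (1 - (\<alpha> * t + \<beta> * t')) *\<^sub>R a'' + (\<alpha> * t + \<beta> * t') *\<^sub>R b''" .
    have "0 \<le> \<alpha> * (1 - t) + \<beta> * (1 - t')" using w w' \<alpha>\<beta> by simp
    then have "\<alpha> * t + \<beta> * t' \<le> 1" using weight by simp
    moreover have "0 \<le> \<alpha> * t + \<beta> * t'" using w w' \<alpha>\<beta> by simp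
    ultimately show "\<alpha> *\<^sub>R w + \<beta> *\<^sub>R w' \<in> ?W"
      using eq a''(1) b''(1) by blast
  qed
qed

text \<open>
  Compactness of the unit interval allows the weights of the approximating convex combinations to
  be replaced by their limit \<open>t\<close>; boundedness of the two sets makes the resulting error vanish.
\<close>
lemma closure_convex_hull_Un_sequences:
  fixes C1 C2 :: "'a::real_normed_vector set"
  assumes C: "convex C1" "convex C2" "C1 \<noteq> {}" "C2 \<noteq> {}" "bounded C1" "bounded C2"
    and x: "x \<in> closure (convex hull (C1 \<union> C2))"
  obtains t a b where "0 \<le> t" "t \<le> 1" "\<And>n::nat. a n \<in> C1" "\<And>n. b n \<in> C2"
    "(\<lambda>n. (1 - t) *\<^sub>R a n + t *\<^sub>R b n) \<longlonglongrightarrow> x"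
proof -
  obtain y where y: "\<And>n::nat. y n \<in> convex hull (C1 \<union> C2)" "y \<longlonglongrightarrow> x"
    using x unfolding closure_sequential by auto
  have "\<exists>t a b. y n = (1 - t) *\<^sub>R a + t *\<^sub>R b \<and> t \<in> {0..1} \<and> a \<in> C1 \<and> b \<in> C2" for n
    using subsetD[OF convex_hull_Un_subset[OF C(1-4)] y(1)[of n]] by auto
  then obtain s a b where ab: "\<And>n. y n = (1 - s n) *\<^sub>R a n + s n *\<^sub>R b n"
      "\<And>n. s n \<in> {0..1::real}" "\<And>n. a n \<in> C1" "\<And>n. b n \<in> C2"
    by metis
  have "seq_compact {0..1::real}" by (simp add: seq_compact_eq_compact)
  then obtain t \<sigma> where t: "t \<in> {0..1}" "strict_mono \<sigma>" "(s \<circ> \<sigma>) \<longlonglongrightarrow> t"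
    using ab(2) by (meson seq_compactE)
  obtain M1 M2 where M: "\<And>c. c \<in> C1 \<Longrightarrow> norm c \<le> M1" "\<And>c. c \<in> C2 \<Longrightarrow> norm c \<le> M2"
    using C(5,6) by (auto simp: bounded_iff)
  have "norm (a (\<sigma> n) - b (\<sigma> n)) \<le> M1 + M2" for n
    using norm_triangle_ineq4[of "a (\<sigma> n)" "b (\<sigma> n)"] M(1)[OF ab(3), of "\<sigma> n"] M(2)[OF ab(4), of "\<sigma> n"]
    by linarith
  then have "Bseq (\<lambda>n. a (\<sigma> n) - b (\<sigma> n))" by (rule BseqI')
  moreover have "Zfun (\<lambda>n. s (\<sigma> n) - t) sequentially"
    using t(3) by (simp add: tendsto_Zfun_iff comp_def)
  ultimately have "Zfun (\<lambda>n. (s (\<sigma> n) - t) *\<^sub>R (a (\<sigma> n) - b (\<sigma> n))) sequentially"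
    using bounded_bilinear.Zfun_prod_Bfun[OF bounded_bilinear_scaleR] by blast
  then have "(\<lambda>n. (s (\<sigma> n) - t) *\<^sub>R (a (\<sigma> n) - b (\<sigma> n))) \<longlonglongrightarrow> 0"
    by (simp add: tendsto_Zfun_iff)
  moreover have "(\<lambda>n. y (\<sigma> n)) \<longlonglongrightarrow> x"
    using LIMSEQ_subseq_LIMSEQ[OF y(2) t(2)] by (simp add: comp_def)
  ultimately have "(\<lambda>n. y (\<sigma> n) + (s (\<sigma> n) - t) *\<^sub>R (a (\<sigma> n) - b (\<sigma> n))) \<longlonglongrightarrow> x"
    using tendsto_add by fastforce
  moreover have "y (\<sigma> n) + (s (\<sigma> n) - t) *\<^sub>R (a (\<sigma> n) - b (\<sigma> n)) = (1 - t) *\<^sub>R a (\<sigma> n) + t *\<^sub>R b (\<sigma> n)" for n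
    unfolding ab(1) by (simp add: algebra_simps)
  ultimately show thesis
    using that[of t "\<lambda>n. a (\<sigma> n)" "\<lambda>n. b (\<sigma> n)"] t(1) ab(3,4) by simp
qed

text \<open>
  Write \<open>x\<close> as the limit of \<open>(1 - t) *\<^sub>R a n + t *\<^sub>R b n\<close>. If \<open>0 < t < 1\<close>, a weak* cluster point \<open>u\<close>
  of \<open>a\<close> determines a companion \<open>v\<close> with \<open>x = (1 - t) *\<^sub>R u + t *\<^sub>R v\<close>, and both belong to the weak*
  closure of \<open>A\<close>. Extremality gives \<open>u = x\<close>, so \<open>x\<close> is in the weak closure of the convex set \<open>C1\<close>,
  which is its norm closure. If \<open>t\<close> is \<open>0\<close> or \<open>1\<close>, one of the two sequences converges to \<open>x\<close>.
\<close>
lemma bidual_extreme_point_closure_Un: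
  fixes x :: "'a::real_normed_vector"
  assumes ext: "bidual_embedding x extreme_point_of
       (weak_star_topology closure_of (bidual_embedding ` A))"
    and C1: "convex C1" "bounded C1" "C1 \<subseteq> A" and C2: "convex C2" "bounded C2" "C2 \<subseteq> A"
    and x: "x \<in> closure (convex hull (C1 \<union> C2))"
  shows "x \<in> closure C1 \<or> x \<in> closure C2"
proof (cases "C1 = {} \<or> C2 = {}")
  case True
  then show ?thesis using x C1(1) C2(1) by (auto simp: hull_same)
next
  case False
  then obtain t a b where t: "0 \<le> t" "t \<le> 1" and ab: "\<And>n::nat. a n \<in> C1" "\<And>n. b n \<in> C2"
    and lim: "(\<lambda>n. (1 - t) *\<^sub>R a n + t *\<^sub>R b n) \<longlonglongrightarrow> x"
    using closure_convex_hull_Un_sequences[OF C1(1) C2(1) _ _ C1(2) C2(2) x] by metis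
  consider "t = 0" | "t = 1" | "0 < t" "t < 1" using t by linarith
  then show ?thesis
  proof cases
    case 1
    with lim ab(1) show ?thesis by (auto simp: closure_sequential)
  next
    case 2
    with lim ab(2) show ?thesis by (auto simp: closure_sequential)
  next
    case 3
    have "bounded (range a)" using C1(2) by (rule bounded_subset) (use ab in auto)
    then obtain u :: "('a \<Rightarrow>\<^sub>L real) \<Rightarrow>\<^sub>L real" where u:
      "\<And>F \<delta>. finite F \<Longrightarrow> 0 < \<delta> \<Longrightarrow>
         \<exists>\<^sub>F n in sequentially. \<forall>f\<in>F. \<bar>blinfun_apply f (a n) - blinfun_apply u f\<bar> < \<delta>"
      by (rule bounded_sequence_weak_star_cluster_point) blast
    \<comment> \<open>The only possible partner of \<open>u\<close> in a convex combination that represents \<open>x\<close>.\<close>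
    define v where "v = (1 / t) *\<^sub>R (bidual_embedding x - (1 - t) *\<^sub>R u)"
    have comb: "bidual_embedding x = (1 - t) *\<^sub>R u + t *\<^sub>R v" using 3 by (simp add: v_def)
    have "u \<in> weak_star_topology closure_of (bidual_embedding ` A)"
      unfolding bidual_embedding_closure_iff
    proof (intro allI impI)
      fix F :: "('a \<Rightarrow>\<^sub>L real) set" and \<delta> :: real assume "finite F" "0 < \<delta>"
      from frequently_ex[OF u[OF this]] ab(1) C1(3)
      show "\<exists>s\<in>A. \<forall>f\<in>F. \<bar>blinfun_apply f s - blinfun_apply u f\<bar> < \<delta>" by blast
    qed
    moreover have "v \<in> weak_star_topology closure_of (bidual_embedding ` A)"
      unfolding bidual_embedding_closure_iff
    proof (intro allI impI)
      fix F :: "('a \<Rightarrow>\<^sub>L real) set" and \<delta> :: real assume F: "finite F" "0 < \<delta>"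
      define z where "z n = (1 - t) *\<^sub>R a n + t *\<^sub>R b n" for n
      define \<eta> where "\<eta> = t * \<delta> / 2"
      have \<eta>: "0 < \<eta>" using 3 F by (simp add: \<eta>_def)
      have "\<forall>\<^sub>F n in sequentially. \<bar>blinfun_apply f (z n) - blinfun_apply f x\<bar> < \<eta>" for f :: "'a \<Rightarrow>\<^sub>L real"
      proof -
        have "(\<lambda>n. blinfun_apply f (z n)) \<longlonglongrightarrow> blinfun_apply f x"
          unfolding z_def by (intro tendsto_intros lim)
        from tendstoD[OF this \<eta>] show ?thesis by (simp add: dist_real_def)
      qed
      then have "\<forall>\<^sub>F n in sequentially. \<forall>f\<in>F. \<bar>blinfun_apply f (z n) - blinfun_apply f x\<bar> < \<eta>"
        using F(1) by (simp add: eventually_ball_finite)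
      \<comment> \<open>A single index must serve for \<open>u\<close>, where approximation is only frequent, and for \<open>z\<close>.\<close>
      from frequently_ex[OF frequently_eventually_frequently[OF u[OF F(1) \<eta>] this]]
      obtain n where n: "\<forall>f\<in>F. \<bar>blinfun_apply f (a n) - blinfun_apply u f\<bar> < \<eta>"
          "\<forall>f\<in>F. \<bar>blinfun_apply f (z n) - blinfun_apply f x\<bar> < \<eta>"
        by blast
      have "\<bar>blinfun_apply f (b n) - blinfun_apply v f\<bar> < \<delta>" if f: "f \<in> F" for f
      proof -
        have "blinfun_apply f (z n) = (1 - t) * blinfun_apply f (a n) + t * blinfun_apply f (b n)"
          by (simp add: z_def blinfun.add_right blinfun.scaleR_right)
        moreover have "blinfun_apply f x = (1 - t) * blinfun_apply u f + t * blinfun_apply v f"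
          using arg_cong[OF comb, of "\<lambda>w. blinfun_apply w f"]
          by (simp add: blinfun.add_left blinfun.scaleR_left)
        ultimately have "t * (blinfun_apply f (b n) - blinfun_apply v f)
            = (blinfun_apply f (z n) - blinfun_apply f x)
              - (1 - t) * (blinfun_apply f (a n) - blinfun_apply u f)"
          by (simp add: right_diff_distrib)
        also have "\<bar>\<dots>\<bar> \<le> \<bar>blinfun_apply f (z n) - blinfun_apply f x\<bar>
              + \<bar>(1 - t) * (blinfun_apply f (a n) - blinfun_apply u f)\<bar>"
          by (rule abs_triangle_ineq4)
        also have "\<dots> \<le> \<bar>blinfun_apply f (z n) - blinfun_apply f x\<bar>
              + \<bar>blinfun_apply f (a n) - blinfun_apply u f\<bar>"
          using 3 by (intro add_left_mono) (simp add: abs_mult mult_left_le_one_le)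
        also have "\<dots> < \<eta> + \<eta>" using n f by (intro add_strict_mono) auto
        also have "\<eta> + \<eta> = t * \<delta>" by (simp add: \<eta>_def)
        finally show ?thesis using 3 by (simp add: abs_mult)
      qed
      then show "\<exists>s\<in>A. \<forall>f\<in>F. \<bar>blinfun_apply f s - blinfun_apply v f\<bar> < \<delta>"
        using ab(2)[of n] C2(3) by blast
    qed
    ultimately have "bidual_embedding x \<notin> open_segment u v"
      using ext unfolding extreme_point_of_def by blast
    then have "u = v" using comb 3 by (auto simp: in_segment)
    then have u_eq: "u = bidual_embedding x" using comb by (simp add: algebra_simps)
    have "x \<in> closure C1"
    proof (rule ccontr)
      assume "x \<notin> closure C1"
      then obtain f :: "'a \<Rightarrow>\<^sub>L real" and r where fr: "0 < r"
          "\<And>c. c \<in> C1 \<Longrightarrow> blinfun_apply f c \<le> blinfun_apply f x - r"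
        using separate_point_convex[OF C1(1)] by blast
      obtain n where "\<bar>blinfun_apply f (a n) - blinfun_apply u f\<bar> < r"
        using frequently_ex[OF u[of "{f}" r]] fr(1) by auto
      with fr(2)[OF ab(1)[of n]] show False by (simp add: u_eq)
    qed
    then show ?thesis ..
  qed
qed

lemma bidual_extreme_point_closure_Union:
  fixes x :: "'a::real_normed_vector"
  assumes ext: "bidual_embedding x extreme_point_of
       (weak_star_topology closure_of (bidual_embedding ` A))"
    and A: "convex A" and fin: "finite \<C>"
    and \<C>: "\<And>C. C \<in> \<C> \<Longrightarrow> convex C \<and> bounded C \<and> C \<subseteq> A"
    and x: "x \<in> closure (convex hull (\<Union>\<C>))"
  shows "\<exists>C\<in>\<C>. x \<in> closure C"
  using fin \<C> x
proof (induction \<C>)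
  case empty
  then show ?case by simp
next
  case (insert C \<C>)
  let ?D = "convex hull (\<Union>\<C>)"
  have "convex hull (\<Union>(insert C \<C>)) \<subseteq> convex hull (C \<union> ?D)"
    by (rule hull_mono) (use hull_subset[of "\<Union>\<C>" convex] in auto)
  with insert.prems(2) have "x \<in> closure (convex hull (C \<union> ?D))"
    using closure_mono by blast
  moreover have "bounded ?D"
    using insert.hyps(1) insert.prems(1) by (intro bounded_convex_hull bounded_Union) auto
  moreover have "?D \<subseteq> A"
    using insert.prems(1) A by (intro hull_minimal) auto
  ultimately have "x \<in> closure C \<or> x \<in> closure ?D"
    using insert.prems(1)[of C] by (intro bidual_extreme_point_closure_Un[OF ext]) auto
  with insert.IH insert.prems(1) show ?case by auto
qed

text \<open>
  Points of \<open>A\<close> at distance exactly \<open>e\<close> from \<open>x\<close> avoid a weak neighbourhood of \<open>x\<close>, so they are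
  covered by finitely many bounded convex pieces of \<open>A\<close>, each cut out by a closed half-space that
  does not contain \<open>x\<close>. Since \<open>x\<close> is extreme in the bidual, it is not in the closed convex hull of
  these pieces, and a functional \<open>g\<close> separates it from them. Because \<open>A\<close> is convex, each point of
  \<open>A\<close> further away is joined to \<open>x\<close> by a segment in \<open>A\<close> that crosses the sphere, and so \<open>g\<close>
  separates \<open>x\<close> from it by the same margin. The detour through the sphere is what makes
  the argument work for unbounded \<open>A\<close>.
\<close>
lemma preserved_extreme_point_imp_denting_point:
  fixes x :: "'a::real_normed_vector"
  assumes A: "convex A" and x: "x \<in> A" and pc: "point_of_continuity A x"
    and pres: "preserved_extreme_point A x"
  shows "denting_point A x"
  unfolding denting_point_def
proof (intro conjI allI impI x)
  fix e :: real assume e: "0 < e"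
  from point_of_continuity_box[OF pc x e]
  obtain F :: "('a \<Rightarrow>\<^sub>L real) set" and \<delta> where F: "finite F" "0 < \<delta>"
    "\<And>y. y \<in> A \<Longrightarrow> (\<And>f. f \<in> F \<Longrightarrow> \<bar>blinfun_apply f (y - x)\<bar> < \<delta>) \<Longrightarrow> dist x y < e"
    by blast
  define H where "H f s = {y. \<delta> \<le> s * blinfun_apply f (y - x)}" for f :: "'a \<Rightarrow>\<^sub>L real" and s :: real
  define \<C> where "\<C> = (\<lambda>(f, s). A \<inter> cball x e \<inter> H f s) ` (F \<times> {1, - 1})"
  have H_closed: "closed (H f s)" for f s
    unfolding H_def by (intro closed_Collect_le continuous_intros)
  have H_convex: "convex (H f s)" for f s
  proof -
    have "H f s = (\<lambda>y. blinfun_apply (s *\<^sub>R f) y) -` {\<delta> + s * blinfun_apply f x..}"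
      by (auto simp: H_def blinfun.diff_right blinfun.scaleR_left right_diff_distrib)
    moreover have "linear (\<lambda>y. blinfun_apply (s *\<^sub>R f) y)"
      by (simp add: bounded_linear.linear blinfun.bounded_linear_right)
    ultimately show ?thesis by (simp add: convex_linear_vimage)
  qed
  have "x \<notin> closure C" if C: "C \<in> \<C>" for C
  proof
    assume "x \<in> closure C"
    moreover obtain f s where "C \<subseteq> H f s" using C by (auto simp: \<C>_def)
    ultimately have "x \<in> H f s" using closure_minimal[OF _ H_closed] by blast
    with F(2) show False by (simp add: H_def)
  qed
  moreover have "convex C \<and> bounded C \<and> C \<subseteq> A" if "C \<in> \<C>" for C
    using that A H_convex by (auto simp: \<C>_def intro!: convex_Int)
  moreover have "finite \<C>" using F(1) by (simp add: \<C>_def)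
  ultimately have "x \<notin> closure (convex hull (\<Union>\<C>))"
    using bidual_extreme_point_closure_Union[of x A \<C>] pres A
    unfolding preserved_extreme_point_def by blast
  then obtain g :: "'a \<Rightarrow>\<^sub>L real" and r where g: "0 < r"
      "\<And>c. c \<in> convex hull (\<Union>\<C>) \<Longrightarrow> blinfun_apply g c \<le> blinfun_apply g x - r"
    using separate_point_convex[OF convex_convex_hull] by blast
  have sphere: "blinfun_apply g z \<le> blinfun_apply g x - r" if z: "z \<in> A" "dist x z = e" for z
  proof -
    obtain f where f: "f \<in> F" "\<delta> \<le> \<bar>blinfun_apply f (z - x)\<bar>"
      using F(3)[OF z(1)] z(2) by force
    then have "z \<in> H f 1 \<or> z \<in> H f (- 1)" by (auto simp: H_def abs_if split: if_splits)
    then have "z \<in> \<Union>\<C>" using f(1) z by (auto simp: \<C>_def intro!: bexI[of _ f])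
    then show ?thesis by (intro g(2) hull_inc)
  qed
  have "A - ball x e \<subseteq> {y. blinfun_apply g y \<le> blinfun_apply g x - r}"
  proof
    fix y assume y: "y \<in> A - ball x e"
    \<comment> \<open>The factor that moves \<open>y\<close> radially onto the sphere of radius \<open>e\<close> around \<open>x\<close>.\<close>
    define s where "s = e / dist x y"
    have d: "e \<le> dist x y" using y by auto
    then have s: "0 < s" "s \<le> 1" "s * dist x y = e"
      using e less_le_trans[OF e d] by (auto simp: s_def)
    have "(1 - s) *\<^sub>R x + s *\<^sub>R y \<in> A" using y x s by (intro convexD[OF A]) auto
    moreover have "dist x ((1 - s) *\<^sub>R x + s *\<^sub>R y) = e"
    proof -
      have "x - ((1 - s) *\<^sub>R x + s *\<^sub>R y) = s *\<^sub>R (x - y)" by (simp add: algebra_simps)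
      then show ?thesis using s by (simp add: dist_norm)
    qed
    ultimately have "blinfun_apply g ((1 - s) *\<^sub>R x + s *\<^sub>R y) \<le> blinfun_apply g x - r"
      by (rule sphere)
    then have *: "r \<le> s * (blinfun_apply g x - blinfun_apply g y)"
      by (simp only: blinfun.add_right blinfun.scaleR_right) (simp add: algebra_simps)
    with g(1) have "0 < s * (blinfun_apply g x - blinfun_apply g y)" by linarith
    then have "0 \<le> blinfun_apply g x - blinfun_apply g y" using s(1) by (simp add: zero_less_mult_iff)
    then have "s * (blinfun_apply g x - blinfun_apply g y) \<le> blinfun_apply g x - blinfun_apply g y"
      using s by (simp add: mult_left_le_one_le)
    with * show "y \<in> {y. blinfun_apply g y \<le> blinfun_apply g x - r}" by simp
  qed
  moreover have "convex {y. blinfun_apply g y \<le> blinfun_apply g x - r}"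
  proof -
    have "linear (blinfun_apply g)"
      by (simp add: bounded_linear.linear blinfun.bounded_linear_right)
    then have "convex (blinfun_apply g -` {..blinfun_apply g x - r})"
      by (rule convex_linear_vimage) simp
    then show ?thesis by (simp add: vimage_def)
  qed
  ultimately have "convex hull (A - ball x e) \<subseteq> {y. blinfun_apply g y \<le> blinfun_apply g x - r}"
    by (rule hull_minimal)
  moreover have "closed {y. blinfun_apply g y \<le> blinfun_apply g x - r}"
    by (intro closed_Collect_le continuous_intros)
  ultimately have "closure (convex hull (A - ball x e)) \<subseteq> {y. blinfun_apply g y \<le> blinfun_apply g x - r}"
    by (rule closure_minimal)
  with g(1) show "x \<notin> closure (convex hull (A - ball x e))" by auto
qed

theorem theorem4:
  fixes A :: "'a::real_normed_vector set" and x :: 'a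
  assumes "convex A" and "x \<in> A"
  shows "(denting_point A x \<longleftrightarrow>
            point_of_continuity A x \<and> weakly_strongly_extreme_point A x) \<and>
         (point_of_continuity A x \<and> weakly_strongly_extreme_point A x \<longleftrightarrow>
            point_of_continuity A x \<and> preserved_extreme_point A x)"
  using assms denting_point_imp_point_of_continuity[of A x]
    denting_point_imp_weakly_strongly_extreme_point[of A x]
    weakly_strongly_extreme_point_imp_preserved_extreme_point[of A x]
    preserved_extreme_point_imp_denting_point[of A x]
  by blast

end
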